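(* Let $\mathcal A$, $\varepsilon$, $a$, $R^{\pm}$ be as in the context, let $\sigma^I=(\sigma^I_{\alpha\dot\beta})$ $(I=0,1,2,3)$ be four linearly independent complex $2\times2$ matrices, and let $X_{\alpha\dot\beta}=X_I\,\sigma^I_{\alpha\dot\beta}$ be a bispinor with $\Delta_L(X_{\alpha\dot\beta})=M_\alpha{}^{\sigma}M_{\dot\beta}{}^{\dot\rho}\otimes X_{\sigma\dot\rho}$. Then, for each of the two choices of sign: (a) There exist four $2\times2$ matrices $\overline\sigma_\pm^{I\dot\alpha\beta}$, given by $$\overline\sigma_{\pm}^{I\dot\alpha\beta}=\varepsilon^{\dot\alpha\dot\lambda}\,R^{\mp\sigma\dot\rho}_{\ \ \dot\lambda\nu}\,\varepsilon^{\nu\beta}\,\sigma^I_{\sigma\dot\rho},$$ such that $X_\pm^{\dot\alpha\beta}:=X_I\,\overline\sigma_\pm^{I\dot\alpha\beta}$ transforms under the left coaction as $$\Delta_L(X_\pm^{\dot\alpha\beta})=S^{-1}(M_{\dot\sigma}{}^{\dot\alpha})\,S(M_\rho{}^{\beta})\otimes X_\pm^{\dot\sigma\rho}.$$ (b) The matrices $\overline\sigma_\pm^{I}$ are hermitean (i.e. $(\overline\sigma_\pm^{I\dot\alpha\beta})^\star=\overline\sigma_\pm^{I\dot\beta\alpha}$) if and only if the matrices $\sigma^I$ are hermitean (i.e. $(\sigma^I_{\alpha\dot\beta})^\star=\sigma^I_{\beta\dot\alpha}$). In this case the $X_I$ are real, i.e. $(X_I)^\star=X_I$.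
   Context: Conventions. Spinor indices $\alpha,\beta,\dots$ and dotted indices $\dot\alpha,\dot\beta,\dots$ run over $\{1,2\}$; $I,J,\dots$ run over $\{0,1,2,3\}$. Repeated indices are summed; an undotted index $\alpha$ and the dotted index $\dot\alpha$ with the same letter have the same numerical value, and a letter appearing once dotted and once undotted in the definition of a coefficient denotes the same value. On complex numbers $\star$ is complex conjugation. In formulas with $\pm,\mp$ the upper signs go together and the lower signs go together. Spinor metric. $(\varepsilon_{\alpha\beta})$ is an invertible complex $2\times2$ matrix with inverse $(\varepsilon^{\alpha\beta})$: $\varepsilon^{\alpha\gamma}\varepsilon_{\gamma\beta}=\delta^\alpha_\beta=\varepsilon_{\beta\gamma}\varepsilon^{\gamma\alpha}$. Dotted versions: $\varepsilon_{\dot\beta\dot\alpha}:=(\varepsilon_{\alpha\beta})^\star$, $\varepsilon^{\dot\beta\dot\alpha}:=(\varepsilon^{\alpha\beta})^\star$. It is assumed that $\varepsilon_{\dot\beta\dot\alpha}=-\varepsilon^{\alpha\beta}$ and $\varepsilon^{\dot\beta\dot\alpha}=-\varepsilon_{\alpha\beta}$. $R$ matrices. $a\neq0$ is a real number with $a+a^{-1}+\varepsilon^{\alpha\beta}\varepsilon_{\alpha\beta}=0$ (then $a>0$, and $a^{1/2}$ is the positive root), and $R^{\pm\alpha\beta}_{\ \ \gamma\delta}=\delta^\alpha_\gamma\delta^\beta_\delta+a^{\pm1}\varepsilon^{\alpha\beta}\varepsilon_{\gamma\delta}$. Mixed $R$ matrices are defined by $R^{\pm\dot\delta\gamma}_{\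 \ \alpha\dot\sigma}:=a^{\pm1/2}R^{\mp\gamma\sigma}_{\ \ \delta\alpha}$ and $R^{\mp\gamma\dot\delta}_{\ \ \dot\sigma\alpha}:=a^{\pm1/2}\varepsilon_{\delta\lambda}R^{\mp\gamma\lambda}_{\ \ \nu\alpha}\varepsilon^{\nu\sigma}$. The $\star$-Hopf algebra $\mathcal A$ (quantum $SL(2,\mathbb C)$). $\mathcal A$ is a complex unital $\star$-algebra (with $\star$ antilinear and antimultiplicative) generated by $M_\alpha{}^\beta$ and $M_{\dot\alpha}{}^{\dot\beta}:=(M_\alpha{}^\beta)^\star$, satisfying $\varepsilon_{\alpha\beta}M_\gamma{}^\alpha M_\delta{}^\beta=\varepsilon_{\gamma\delta}I$, $\varepsilon^{\gamma\delta}M_\gamma{}^\alpha M_\delta{}^\beta=\varepsilon^{\alpha\beta}I$, the same relations with all indices dotted, and, for both signs, $M_\alpha{}^\gamma M_{\dot\sigma}{}^{\dot\delta}R^{\pm\dot\rho\beta}_{\ \ \gamma\dot\delta}=R^{\pm\dot\delta\gamma}_{\ \ \alpha\dot\sigma}M_{\dot\delta}{}^{\dot\rho}M_\gamma{}^\beta$. It is a $\star$-Hopf algebra with $\Delta(M_\alpha{}^\beta)=M_\alpha{}^\gamma\otimes M_\gamma{}^\beta$, counit $\varepsilon(M_\alpha{}^\beta)=\delta_\alpha^\beta$, antipode $S(M_\alpha{}^\beta)=\varepsilon_{\alpha\gamma}M_\delta{}^\gamma\varepsilon^{\delta\beta}$, and the same formulas with dotted indices; hence $S^{-1}(M_{\dot\alpha}{}^{\dot\beta})=\varepsilon^{\dot\beta\dot\delta}M_{\dot\delta}{}^{\dot\gamma}\varepsilon_{\dot\gamma\dot\alpha}$.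 Bispinors. $X_{\alpha\dot\beta}$ is a product of an undotted and a dotted right-invariant basis element (so it behaves as $\theta_\alpha\theta_{\dot\beta}$ with $(\theta_\alpha)^\star=\theta_{\dot\alpha}$); thus the $X_{\alpha\dot\beta}$ are four linearly independent elements of a complex vector space with a left $\mathcal A$-coaction $\Delta_L$ given in the claim and an antilinear involution with $(X_{\alpha\dot\beta})^\star=X_{\beta\dot\alpha}$. Since the $\sigma^I$ form a basis of $2\times 2$ matrices, the expansion $X_{\alpha\dot\beta}=X_I\sigma^I_{\alpha\dot\beta}$ defines the $X_I$ uniquely. *)

theory Defs
  imports "HOL-Analysis.Analysis" "HOL-Library.Poly_Mapping"
begin

section \<open>Complex vector spaces and complex unital algebras\<close>

class complex_vector = ab_group_add +
  fixes scaleC :: "complex \<Rightarrow> 'a \<Rightarrow> 'a" (infixr "*\<^sub>C" 75)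
  assumes scaleC_add_right: "c *\<^sub>C (x + y) = c *\<^sub>C x + c *\<^sub>C y"
    and scaleC_add_left: "(c + d) *\<^sub>C x = c *\<^sub>C x + d *\<^sub>C x"
    and scaleC_scaleC: "c *\<^sub>C d *\<^sub>C x = (c * d) *\<^sub>C x"
    and scaleC_one: "1 *\<^sub>C x = x"

class complex_algebra_1 = complex_vector + ring_1 +
  assumes mult_scaleC_left: "(c *\<^sub>C x) * y = c *\<^sub>C (x * y)"
    and mult_scaleC_right: "x * (c *\<^sub>C y) = c *\<^sub>C (x * y)"

lemma vector_space_scaleC: "vector_space (scaleC :: complex \<Rightarrow> 'a::complex_vector \<Rightarrow> 'a)"
  by unfold_locales (simp_all add: scaleC_add_right scaleC_add_left scaleC_scaleC scaleC_one)

lemma scaleC_zero_left [simp]: "0 *\<^sub>C x = (0 :: 'a::complex_vector)"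
  using scaleC_add_left[of 0 0 x] by simp

lemma scaleC_zero_right [simp]: "c *\<^sub>C 0 = (0 :: 'a::complex_vector)"
  using scaleC_add_right[of c "0 :: 'a" 0] by simp

instantiation complex :: complex_algebra_1
begin
definition scaleC_complex :: "complex \<Rightarrow> complex \<Rightarrow> complex"
  where "scaleC_complex c x = c * x"
instance by standard (simp_all add: scaleC_complex_def algebra_simps)
end

instantiation vec :: (complex_vector, finite) complex_vector
begin
definition scaleC_vec :: "complex \<Rightarrow> 'a ^ 'b \<Rightarrow> 'a ^ 'b"
  where "scaleC_vec c x = (\<chi> i. c *\<^sub>C x $ i)"
instance
  by standard (simp_all add: scaleC_vec_def vec_eq_iff scaleC_add_right scaleC_add_left
      scaleC_scaleC scaleC_one)
end

abbreviation clinear :: "('a::complex_vector \<Rightarrow> 'b::complex_vector) \<Rightarrow> bool"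
  where "clinear \<equiv> Vector_Spaces.linear scaleC scaleC"

definition antilinear :: "('a::complex_vector \<Rightarrow> 'b::complex_vector) \<Rightarrow> bool"
  where "antilinear f \<longleftrightarrow> (\<forall>x y. f (x + y) = f x + f y) \<and> (\<forall>c x. f (c *\<^sub>C x) = cnj c *\<^sub>C f x)"

definition lin_indep :: "('i::finite \<Rightarrow> 'a::complex_vector) \<Rightarrow> bool"
  where "lin_indep v \<longleftrightarrow> (\<forall>c. (\<Sum>i\<in>UNIV. c i *\<^sub>C v i) = 0 \<longrightarrow> (\<forall>i. c i = 0))"


section \<open>The algebraic tensor product\<close>

text \<open>The tensor product is the free complex vector space on pairs modulo the subspace generated by
  the bilinearity relators. All complex multiples of the relators are listed as generators, so
  closure under addition already gives a subspace.\<close>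

inductive_set tensor_null :: "(('a::complex_vector \<times> 'b::complex_vector) \<Rightarrow>\<^sub>0 complex) set"
  where
    add_left: "Poly_Mapping.single (x + x', y) c - Poly_Mapping.single (x, y) c
        - Poly_Mapping.single (x', y) c \<in> tensor_null"
  | add_right: "Poly_Mapping.single (x, y + y') c - Poly_Mapping.single (x, y) c
        - Poly_Mapping.single (x, y') c \<in> tensor_null"
  | scale_left: "Poly_Mapping.single (d *\<^sub>C x, y) c - Poly_Mapping.single (x, y) (c * d) \<in> tensor_null"
  | scale_right: "Poly_Mapping.single (x, d *\<^sub>C y) c - Poly_Mapping.single (x, y) (c * d) \<in> tensor_null"
  | plus: "p \<in> tensor_null \<Longrightarrow> q \<in> tensor_null \<Longrightarrow> p + q \<in> tensor_null"

definition free_scale :: "complex \<Rightarrow> ('k \<Rightarrow>\<^sub>0 complex) \<Rightarrow> ('k \<Rightarrow>\<^sub>0 complex)"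
  where "free_scale c p = Poly_Mapping.map ((*) c) p"

lemma lookup_free_scale [simp]: "Poly_Mapping.lookup (free_scale c p) k = c * Poly_Mapping.lookup p k"
  by (simp add: free_scale_def Poly_Mapping.map.rep_eq when_def)

lemma free_scale_single: "free_scale c (Poly_Mapping.single k d) = Poly_Mapping.single k (c * d)"
  by (rule poly_mapping_eqI) (simp add: lookup_single when_def)

lemma free_scale_plus: "free_scale c (p + q) = free_scale c p + free_scale c q"
  by (rule poly_mapping_eqI) (simp add: lookup_add algebra_simps)

lemma free_scale_diff: "free_scale c (p - q) = free_scale c p - free_scale c q"
  by (rule poly_mapping_eqI) (simp add: lookup_minus algebra_simps)

lemma tensor_null_scale: "p \<in> tensor_null \<Longrightarrow> free_scale c p \<in> tensor_null"
  by (induction rule: tensor_null.induct)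
    (simp_all add: free_scale_diff free_scale_plus free_scale_single tensor_null.intros
      mult.assoc[symmetric])

lemma tensor_null_zero: "0 \<in> tensor_null"
  using tensor_null.add_left[of 0 0 0 0] by simp

lemma tensor_null_uminus: "p \<in> tensor_null \<Longrightarrow> - p \<in> tensor_null"
proof -
  assume "p \<in> tensor_null"
  moreover have "free_scale (-1) p = - p"
    by (rule poly_mapping_eqI) simp
  ultimately show ?thesis using tensor_null_scale by metis
qed

definition tensor_rel ::
    "(('a::complex_vector \<times> 'b::complex_vector) \<Rightarrow>\<^sub>0 complex) \<Rightarrow> (('a \<times> 'b) \<Rightarrow>\<^sub>0 complex) \<Rightarrow> bool"
  where "tensor_rel p q \<longleftrightarrow> p - q \<in> tensor_null"

lemma tensor_rel_trans: "tensor_rel p q \<Longrightarrow> tensor_rel q r \<Longrightarrow> tensor_rel p r"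
  unfolding tensor_rel_def using tensor_null.plus[of "p - q" "q - r"] by simp

lemma equivp_tensor_rel: "equivp tensor_rel"
proof (rule equivpI)
  show "reflp tensor_rel"
    by (simp add: reflp_def tensor_rel_def tensor_null_zero)
  show "symp tensor_rel"
    unfolding symp_def tensor_rel_def using tensor_null_uminus by fastforce
  show "transp tensor_rel"
    by (rule transpI) (rule tensor_rel_trans)
qed

quotient_type (overloaded) ('a, 'b) tensor =
  "('a::complex_vector \<times> 'b::complex_vector) \<Rightarrow>\<^sub>0 complex" / tensor_rel
  by (rule equivp_tensor_rel)

instantiation tensor :: (complex_vector, complex_vector) complex_vector
begin
lift_definition zero_tensor :: "('a, 'b) tensor" is 0 .
lift_definition plus_tensor :: "('a, 'b) tensor \<Rightarrow> ('a, 'b) tensor \<Rightarrow> ('a, 'b) tensor" is "(+)"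
  unfolding tensor_rel_def add_diff_add by (rule tensor_null.plus)
lift_definition uminus_tensor :: "('a, 'b) tensor \<Rightarrow> ('a, 'b) tensor" is uminus
  unfolding tensor_rel_def minus_diff_minus by (rule tensor_null_uminus)
definition minus_tensor :: "('a, 'b) tensor \<Rightarrow> ('a, 'b) tensor \<Rightarrow> ('a, 'b) tensor"
  where "minus_tensor s t = s + - t"
lift_definition scaleC_tensor :: "complex \<Rightarrow> ('a, 'b) tensor \<Rightarrow> ('a, 'b) tensor" is free_scale
  unfolding tensor_rel_def free_scale_diff[symmetric] by (rule tensor_null_scale)
instance
proof
  fix s t u :: "('a, 'b) tensor" and c d :: complex
  have refl: "p = q \<Longrightarrow> tensor_rel p q" for p q :: "('a \<times> 'b) \<Rightarrow>\<^sub>0 complex"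
    by (simp add: tensor_rel_def tensor_null_zero)
  show "s + t + u = s + (t + u)" by transfer (rule refl, simp add: add.assoc)
  show "s + t = t + s" by transfer (rule refl, simp add: add.commute)
  show "0 + s = s" by transfer (rule refl, simp)
  show "- s + s = 0" by transfer (rule refl, simp)
  show "s - t = s + - t" by (rule minus_tensor_def)
  show "c *\<^sub>C (s + t) = c *\<^sub>C s + c *\<^sub>C t" by transfer (rule refl, simp add: free_scale_plus)
  show "(c + d) *\<^sub>C s = c *\<^sub>C s + d *\<^sub>C s"
    by transfer (rule refl, rule poly_mapping_eqI, simp add: lookup_add algebra_simps)
  show "c *\<^sub>C d *\<^sub>C s = (c * d) *\<^sub>C s"
    by transfer (rule refl, rule poly_mapping_eqI, simp)
  show "1 *\<^sub>C s = s"
    by transfer (rule refl, rule poly_mapping_eqI, simp)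
qed
end

lift_definition tensor_of :: "'a::complex_vector \<Rightarrow> 'b::complex_vector \<Rightarrow> ('a, 'b) tensor"
  (infixl "\<otimes>" 70) is "\<lambda>x y. Poly_Mapping.single (x, y) 1" .

text \<open>The map out of the tensor product induced by a bilinear map \<open>f\<close>; with \<open>\<phi> = cnj\<close> instead of the
  identity it is the one induced by a map that is antilinear in both arguments. Both are computed on
  an arbitrary representative, the result being independent of it by \<open>semi_lift_eq\<close> below.\<close>

definition free_lift ::
    "(complex \<Rightarrow> complex) \<Rightarrow> ('a \<Rightarrow> 'b \<Rightarrow> 'c::complex_vector) \<Rightarrow> (('a \<times> 'b) \<Rightarrow>\<^sub>0 complex) \<Rightarrow> 'c"
  where "free_lift \<phi> f p = (\<Sum>(x, y)\<in>Poly_Mapping.keys p. \<phi> (Poly_Mapping.lookup p (x, y)) *\<^sub>C f x y)"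

definition semi_lift :: "(complex \<Rightarrow> complex) \<Rightarrow> ('a::complex_vector \<Rightarrow> 'b::complex_vector
    \<Rightarrow> 'c::complex_vector) \<Rightarrow> ('a, 'b) tensor \<Rightarrow> 'c"
  where "semi_lift \<phi> f t = free_lift \<phi> f (rep_tensor t)"

abbreviation tensor_lift :: "('a::complex_vector \<Rightarrow> 'b::complex_vector \<Rightarrow> 'c::complex_vector)
    \<Rightarrow> ('a, 'b) tensor \<Rightarrow> 'c"
  where "tensor_lift \<equiv> semi_lift (\<lambda>c. c)"

definition tensor_map :: "('a::complex_vector \<Rightarrow> 'c::complex_vector)
    \<Rightarrow> ('b::complex_vector \<Rightarrow> 'd::complex_vector) \<Rightarrow> ('a, 'b) tensor \<Rightarrow> ('c, 'd) tensor"
  where "tensor_map f g = tensor_lift (\<lambda>x y. f x \<otimes> g y)"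

definition tensor_antimap :: "('a::complex_vector \<Rightarrow> 'c::complex_vector)
    \<Rightarrow> ('b::complex_vector \<Rightarrow> 'd::complex_vector) \<Rightarrow> ('a, 'b) tensor \<Rightarrow> ('c, 'd) tensor"
  where "tensor_antimap f g = semi_lift cnj (\<lambda>x y. f x \<otimes> g y)"

definition tensor_assoc :: "(('a::complex_vector, 'b::complex_vector) tensor, 'c::complex_vector) tensor
    \<Rightarrow> ('a, ('b, 'c) tensor) tensor"
  where "tensor_assoc = tensor_lift (\<lambda>t z. tensor_lift (\<lambda>x y. x \<otimes> (y \<otimes> z)) t)"

definition tensor_mult :: "('a::complex_algebra_1, 'b::complex_algebra_1) tensor
    \<Rightarrow> ('a, 'b) tensor \<Rightarrow> ('a, 'b) tensor"
  where "tensor_mult s t = tensor_lift (\<lambda>x y. tensor_lift (\<lambda>x' y'. (x * x') \<otimes> (y * y')) t) s"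

lemma tensor_of_add_left: "(x + x') \<otimes> y = x \<otimes> y + x' \<otimes> y"
  by transfer (simp add: tensor_rel_def diff_diff_eq[symmetric] tensor_null.add_left)

lemma tensor_of_add_right: "x \<otimes> (y + y') = x \<otimes> y + x \<otimes> y'"
  by transfer (simp add: tensor_rel_def diff_diff_eq[symmetric] tensor_null.add_right)

lemma tensor_of_scaleC_left: "(c *\<^sub>C x) \<otimes> y = c *\<^sub>C (x \<otimes> y)"
  by transfer (use tensor_null.scale_left[where c = 1] in \<open>simp add: tensor_rel_def free_scale_single\<close>)

lemma tensor_of_scaleC_right: "x \<otimes> (c *\<^sub>C y) = c *\<^sub>C (x \<otimes> y)"
  by transfer (use tensor_null.scale_right[where c = 1] in \<open>simp add: tensor_rel_def free_scale_single\<close>)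

definition semi_bilinear :: "(complex \<Rightarrow> complex) \<Rightarrow> ('a::complex_vector \<Rightarrow> 'b::complex_vector
    \<Rightarrow> 'c::complex_vector) \<Rightarrow> bool"
  where "semi_bilinear \<phi> f \<longleftrightarrow>
    (\<forall>x x' y. f (x + x') y = f x y + f x' y) \<and> (\<forall>x y y'. f x (y + y') = f x y + f x y') \<and>
    (\<forall>c x y. f (c *\<^sub>C x) y = \<phi> c *\<^sub>C f x y) \<and> (\<forall>c x y. f x (c *\<^sub>C y) = \<phi> c *\<^sub>C f x y)"

lemma free_lift_superset:
  assumes "\<phi> 0 = 0" "finite K" "Poly_Mapping.keys p \<subseteq> K"
  shows "free_lift \<phi> f p = (\<Sum>(x, y)\<in>K. \<phi> (Poly_Mapping.lookup p (x, y)) *\<^sub>C f x y)"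
  unfolding free_lift_def
  by (rule sum.mono_neutral_left) (use assms in \<open>auto simp: in_keys_iff\<close>)

lemma free_lift_plus:
  assumes "\<phi> 0 = 0" "\<And>c d. \<phi> (c + d) = \<phi> c + \<phi> d"
  shows "free_lift \<phi> f (p + q) = free_lift \<phi> f p + free_lift \<phi> f q"
proof -
  let ?K = "Poly_Mapping.keys p \<union> Poly_Mapping.keys q"
  have "Poly_Mapping.keys (p + q) \<subseteq> ?K" by (rule Poly_Mapping.keys_add)
  then show ?thesis
    using assms
    by (simp add: free_lift_superset[where K = ?K] lookup_add scaleC_add_left sum.distrib
        case_prod_beta)
qed

lemma free_lift_single:
  "\<phi> 0 = 0 \<Longrightarrow> free_lift \<phi> f (Poly_Mapping.single (x, y) c) = \<phi> c *\<^sub>C f x y"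
  by (subst free_lift_superset[where K = "{(x, y)}"]) auto

lemma free_lift_diff:
  assumes "\<phi> 0 = 0" "\<And>c d. \<phi> (c + d) = \<phi> c + \<phi> d"
  shows "free_lift \<phi> f (p - q) = free_lift \<phi> f p - free_lift \<phi> f q"
  using free_lift_plus[OF assms, of f "p - q" q] by (simp add: algebra_simps)

lemma free_lift_null:
  assumes "\<phi> = (\<lambda>c. c) \<or> \<phi> = cnj" "semi_bilinear \<phi> f" "p \<in> tensor_null"
  shows "free_lift \<phi> f p = 0"
proof -
  have \<phi>: "\<phi> 0 = 0" "\<And>c d. \<phi> (c + d) = \<phi> c + \<phi> d" "\<And>c d. \<phi> (c * d) = \<phi> c * \<phi> d"
    using assms(1) by auto
  show ?thesis
    using assms(3)
    by (induction rule: tensor_null.induct)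
      (use assms(2) in \<open>simp_all add: free_lift_diff[where \<phi> = \<phi>, OF \<phi>(1,2)] free_lift_plus[where \<phi> = \<phi>, OF \<phi>(1,2)]
        free_lift_single[where \<phi> = \<phi>, OF \<phi>(1)] semi_bilinear_def scaleC_add_right scaleC_scaleC \<phi>(3)\<close>)
qed

lemma semi_lift_eq:
  assumes "\<phi> = (\<lambda>c. c) \<or> \<phi> = cnj" "semi_bilinear \<phi> f"
  shows "semi_lift \<phi> f (abs_tensor p) = free_lift \<phi> f p"
proof -
  have \<phi>: "\<phi> 0 = 0" "\<And>c d. \<phi> (c + d) = \<phi> c + \<phi> d"
    using assms(1) by auto
  have "tensor_rel (rep_tensor (abs_tensor p)) p"
    by (rule Quotient3_rep_abs[OF Quotient3_tensor]) (simp add: tensor_rel_def tensor_null_zero)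
  then have "free_lift \<phi> f (rep_tensor (abs_tensor p) - p) = 0"
    by (intro free_lift_null assms) (simp add: tensor_rel_def)
  then show ?thesis
    by (simp add: semi_lift_def free_lift_diff[where \<phi> = \<phi>, OF \<phi>])
qed

lemma semi_lift_tensor_of:
  assumes "\<phi> = (\<lambda>c. c) \<or> \<phi> = cnj" "semi_bilinear \<phi> f"
  shows "semi_lift \<phi> f (x \<otimes> y) = f x y"
proof -
  have "\<phi> 0 = 0" "\<phi> 1 = 1" using assms(1) by auto
  then show ?thesis
    by (simp add: tensor_of.abs_eq semi_lift_eq[OF assms] free_lift_single scaleC_one)
qed

lemma semi_lift_add:
  assumes "\<phi> = (\<lambda>c. c) \<or> \<phi> = cnj" "semi_bilinear \<phi> f"
  shows "semi_lift \<phi> f (s + t) = semi_lift \<phi> f s + semi_lift \<phi> f t"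
proof -
  have "\<phi> 0 = 0" "\<And>c d. \<phi> (c + d) = \<phi> c + \<phi> d" using assms(1) by auto
  moreover obtain p q where "s = abs_tensor p" "t = abs_tensor q"
    by (metis Quotient3_abs_rep[OF Quotient3_tensor])
  ultimately show ?thesis
    by (simp add: plus_tensor.abs_eq semi_lift_eq[OF assms] free_lift_plus)
qed


section \<open>Hopf \<open>\<star>\<close>-algebras and comodules\<close>

locale star_algebra =
  fixes star :: "'a::complex_algebra_1 \<Rightarrow> 'a"
  assumes star_antilinear: "antilinear star"
    and star_mult: "star (x * y) = star y * star x"
    and star_star: "star (star x) = x"

locale hopf_algebra =
  fixes \<Delta> :: "'a::complex_algebra_1 \<Rightarrow> ('a, 'a) tensor"
    and counit :: "'a \<Rightarrow> complex"
    and S :: "'a \<Rightarrow> 'a"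
  assumes linear_\<Delta>: "clinear \<Delta>"
    and \<Delta>_mult: "\<Delta> (x * y) = tensor_mult (\<Delta> x) (\<Delta> y)"
    and \<Delta>_one: "\<Delta> 1 = 1 \<otimes> 1"
    and linear_counit: "clinear counit"
    and counit_mult: "counit (x * y) = counit x * counit y"
    and counit_one: "counit 1 = 1"
    and coassoc: "tensor_assoc (tensor_map \<Delta> (\<lambda>x. x) (\<Delta> x)) = tensor_map (\<lambda>x. x) \<Delta> (\<Delta> x)"
    and counit_left: "tensor_lift (\<lambda>x y. counit x *\<^sub>C y) (\<Delta> x) = x"
    and counit_right: "tensor_lift (\<lambda>x y. counit y *\<^sub>C x) (\<Delta> x) = x"
    and linear_S: "clinear S"
    and antipode_left: "tensor_lift (\<lambda>x y. S x * y) (\<Delta> x) = counit x *\<^sub>C 1"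
    and antipode_right: "tensor_lift (\<lambda>x y. x * S y) (\<Delta> x) = counit x *\<^sub>C 1"

locale star_hopf_algebra = star_algebra star + hopf_algebra \<Delta> counit S
  for star :: "'a::complex_algebra_1 \<Rightarrow> 'a" and \<Delta> counit S +
  assumes \<Delta>_star: "\<Delta> (star x) = tensor_antimap star star (\<Delta> x)"
    and counit_star: "counit (star x) = cnj (counit x)"
    and S_star: "S (star (S (star x))) = x"

locale left_comodule = hopf_algebra \<Delta> counit S
  for \<Delta> :: "'a::complex_algebra_1 \<Rightarrow> ('a, 'a) tensor" and counit S +
  fixes \<Delta>\<^sub>L :: "'v::complex_vector \<Rightarrow> ('a, 'v) tensor"
  assumes linear_\<Delta>\<^sub>L: "clinear \<Delta>\<^sub>L"
    and coaction_assoc: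
      "tensor_assoc (tensor_map \<Delta> (\<lambda>v. v) (\<Delta>\<^sub>L v)) = tensor_map (\<lambda>x. x) \<Delta>\<^sub>L (\<Delta>\<^sub>L v)"
    and coaction_counit: "tensor_lift (\<lambda>x v. counit x *\<^sub>C v) (\<Delta>\<^sub>L v) = v"

inductive_set generated_algebra :: "'a::complex_algebra_1 set \<Rightarrow> 'a set" for G
  where
    gen: "x \<in> G \<Longrightarrow> x \<in> generated_algebra G"
  | one: "1 \<in> generated_algebra G"
  | add: "x \<in> generated_algebra G \<Longrightarrow> y \<in> generated_algebra G \<Longrightarrow> x + y \<in> generated_algebra G"
  | mult: "x \<in> generated_algebra G \<Longrightarrow> y \<in> generated_algebra G \<Longrightarrow> x * y \<in> generated_algebra G"
  | scale: "x \<in> generated_algebra G \<Longrightarrow> c *\<^sub>C x \<in> generated_algebra G"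


section \<open>Spinor metric and R matrices\<close>

text \<open>A matrix \<open>e\<close> stands for \<open>e $ \<alpha> $ \<beta> = \<epsilon>\<^sub>\<alpha>\<^sub>\<beta>\<close>, and \<open>matrix_inv e $ \<alpha> $ \<beta>\<close> for the metric with upper
  indices. Dotted and undotted indices both range over the type \<open>2\<close>.\<close>

definition dotted :: "complex ^ 2 ^ 2 \<Rightarrow> complex ^ 2 ^ 2"
  where "dotted e = (\<chi> \<beta> \<alpha>. cnj (e $ \<alpha> $ \<beta>))"

locale spinor_metric =
  fixes e :: "complex ^ 2 ^ 2" and a :: real
  assumes invertible_e: "invertible e"
    and dotted_lower: "dotted e $ \<beta> $ \<alpha> = - (matrix_inv e $ \<alpha> $ \<beta>)"
    and dotted_upper: "dotted (matrix_inv e) $ \<beta> $ \<alpha> = - (e $ \<alpha> $ \<beta>)"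
    and a_nonzero: "a \<noteq> 0"
    and a_eq: "complex_of_real (a + inverse a)
        + (\<Sum>\<alpha>\<in>UNIV. \<Sum>\<beta>\<in>UNIV. matrix_inv e $ \<alpha> $ \<beta> * e $ \<alpha> $ \<beta>) = 0"

text \<open>Signs are the integers \<open>s = 1\<close> and \<open>s = -1\<close>. In all R matrices the arguments after \<open>s\<close> are first the
  two upper and then the two lower indices, each pair from left to right. Of the mixed matrices,
  \<open>Rdu\<close> has its upper index pair dotted-undotted (and its lower pair undotted-dotted), \<open>Rud\<close> the
  reverse; the displayed sign in the definition of the latter is opposite to the exponent of \<open>a\<close>.\<close>

definition Rmat :: "complex ^ 2 ^ 2 \<Rightarrow> real \<Rightarrow> int \<Rightarrow> 2 \<Rightarrow> 2 \<Rightarrow> 2 \<Rightarrow> 2 \<Rightarrow> complex"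
  where "Rmat e a s \<alpha> \<beta> \<gamma> \<delta> = of_bool (\<alpha> = \<gamma>) * of_bool (\<beta> = \<delta>)
    + complex_of_real (a powi s) * matrix_inv e $ \<alpha> $ \<beta> * e $ \<gamma> $ \<delta>"

definition Rdu :: "complex ^ 2 ^ 2 \<Rightarrow> real \<Rightarrow> int \<Rightarrow> 2 \<Rightarrow> 2 \<Rightarrow> 2 \<Rightarrow> 2 \<Rightarrow> complex"
  where "Rdu e a s \<delta> \<gamma> \<alpha> \<sigma> = complex_of_real (sqrt a powi s) * Rmat e a (- s) \<gamma> \<sigma> \<delta> \<alpha>"

definition Rud :: "complex ^ 2 ^ 2 \<Rightarrow> real \<Rightarrow> int \<Rightarrow> 2 \<Rightarrow> 2 \<Rightarrow> 2 \<Rightarrow> 2 \<Rightarrow> complex"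
  where "Rud e a s \<gamma> \<delta> \<sigma> \<alpha> = complex_of_real (sqrt a powi (- s)) *
    (\<Sum>\<kappa>\<in>UNIV. \<Sum>\<nu>\<in>UNIV. e $ \<delta> $ \<kappa> * Rmat e a s \<gamma> \<kappa> \<nu> \<alpha> * matrix_inv e $ \<nu> $ \<sigma>)"


section \<open>Quantum \<open>SL(2,\<complex>)\<close> and bispinors\<close>

locale quantum_SL2C = spinor_metric e a + star_hopf_algebra star \<Delta> counit S
  for e a and star :: "'a::complex_algebra_1 \<Rightarrow> 'a" and \<Delta> counit S +
  fixes M :: "2 \<Rightarrow> 2 \<Rightarrow> 'a" and Md :: "2 \<Rightarrow> 2 \<Rightarrow> 'a"
  assumes Md_eq: "Md \<alpha> \<beta> = star (M \<alpha> \<beta>)"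
    and generated: "generated_algebra ({M \<alpha> \<beta> |\<alpha> \<beta>. True} \<union> {Md \<alpha> \<beta> |\<alpha> \<beta>. True}) = UNIV"
    and metric_lower: "(\<Sum>\<alpha>\<in>UNIV. \<Sum>\<beta>\<in>UNIV. e $ \<alpha> $ \<beta> *\<^sub>C (M \<gamma> \<alpha> * M \<delta> \<beta>)) = e $ \<gamma> $ \<delta> *\<^sub>C 1"
    and metric_upper: "(\<Sum>\<gamma>\<in>UNIV. \<Sum>\<delta>\<in>UNIV. matrix_inv e $ \<gamma> $ \<delta> *\<^sub>C (M \<gamma> \<alpha> * M \<delta> \<beta>))
        = matrix_inv e $ \<alpha> $ \<beta> *\<^sub>C 1"
    and metric_lower_dotted:
      "(\<Sum>\<alpha>\<in>UNIV. \<Sum>\<beta>\<in>UNIV. dotted e $ \<alpha> $ \<beta> *\<^sub>C (Md \<gamma> \<alpha> * Md \<delta> \<beta>)) = dotted e $ \<gamma> $ \<delta> *\<^sub>C 1"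
    and metric_upper_dotted:
      "(\<Sum>\<gamma>\<in>UNIV. \<Sum>\<delta>\<in>UNIV. dotted (matrix_inv e) $ \<gamma> $ \<delta> *\<^sub>C (Md \<gamma> \<alpha> * Md \<delta> \<beta>))
        = dotted (matrix_inv e) $ \<alpha> $ \<beta> *\<^sub>C 1"
    and mixed: "s \<in> {1, -1} \<Longrightarrow>
        (\<Sum>\<gamma>\<in>UNIV. \<Sum>\<delta>\<in>UNIV. Rdu e a s \<rho> \<beta> \<gamma> \<delta> *\<^sub>C (M \<alpha> \<gamma> * Md \<sigma> \<delta>))
        = (\<Sum>\<delta>\<in>UNIV. \<Sum>\<gamma>\<in>UNIV. Rdu e a s \<delta> \<gamma> \<alpha> \<sigma> *\<^sub>C (Md \<delta> \<rho> * M \<gamma> \<beta>))"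
    and \<Delta>_M: "\<Delta> (M \<alpha> \<beta>) = (\<Sum>\<gamma>\<in>UNIV. M \<alpha> \<gamma> \<otimes> M \<gamma> \<beta>)"
    and \<Delta>_Md: "\<Delta> (Md \<alpha> \<beta>) = (\<Sum>\<gamma>\<in>UNIV. Md \<alpha> \<gamma> \<otimes> Md \<gamma> \<beta>)"
    and counit_M: "counit (M \<alpha> \<beta>) = of_bool (\<alpha> = \<beta>)"
    and counit_Md: "counit (Md \<alpha> \<beta>) = of_bool (\<alpha> = \<beta>)"
    and S_M: "S (M \<alpha> \<beta>) = (\<Sum>\<gamma>\<in>UNIV. \<Sum>\<delta>\<in>UNIV. (e $ \<alpha> $ \<gamma> * matrix_inv e $ \<delta> $ \<beta>) *\<^sub>C M \<delta> \<gamma>)"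
    and S_Md: "S (Md \<alpha> \<beta>) = (\<Sum>\<gamma>\<in>UNIV. \<Sum>\<delta>\<in>UNIV.
        (dotted e $ \<alpha> $ \<gamma> * dotted (matrix_inv e) $ \<delta> $ \<beta>) *\<^sub>C Md \<delta> \<gamma>)"

text \<open>\<open>X \<alpha> \<beta>\<close> carries an undotted first and a dotted second index. The star on the comodule is not
  required to be related to the coaction beyond its values on the \<open>X \<alpha> \<beta>\<close>.\<close>

locale bispinor =
  quantum_SL2C e a star \<Delta> counit S M Md + left_comodule \<Delta> counit S \<Delta>\<^sub>L
  for e a and star :: "'a::complex_algebra_1 \<Rightarrow> 'a" and \<Delta> counit S M Md
    and \<Delta>\<^sub>L :: "'v::complex_vector \<Rightarrow> ('a, 'v) tensor" +
  fixes starV :: "'v \<Rightarrow> 'v" and X :: "2 \<Rightarrow> 2 \<Rightarrow> 'v"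
  assumes starV_antilinear: "antilinear starV"
    and starV_starV: "starV (starV v) = v"
    and starV_X: "starV (X \<alpha> \<beta>) = X \<beta> \<alpha>"
    and X_indep: "lin_indep (\<lambda>(\<alpha>, \<beta>). X \<alpha> \<beta>)"
    and \<Delta>\<^sub>L_X: "\<Delta>\<^sub>L (X \<alpha> \<beta>) = (\<Sum>\<sigma>\<in>UNIV. \<Sum>\<rho>\<in>UNIV. (M \<alpha> \<sigma> * Md \<beta> \<rho>) \<otimes> X \<sigma> \<rho>)"

definition hermitean :: "complex ^ 2 ^ 2 \<Rightarrow> bool"
  where "hermitean A \<longleftrightarrow> (\<forall>\<alpha> \<beta>. cnj (A $ \<alpha> $ \<beta>) = A $ \<beta> $ \<alpha>)"

definition sigma_bar ::
    "complex ^ 2 ^ 2 \<Rightarrow> real \<Rightarrow> (4 \<Rightarrow> complex ^ 2 ^ 2) \<Rightarrow> int \<Rightarrow> 4 \<Rightarrow> complex ^ 2 ^ 2"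
  where "sigma_bar e a \<sigma> s I = (\<chi> \<alpha> \<beta>. \<Sum>\<kappa>\<in>UNIV. \<Sum>\<tau>\<in>UNIV. \<Sum>\<rho>\<in>UNIV. \<Sum>\<nu>\<in>UNIV.
    dotted (matrix_inv e) $ \<alpha> $ \<kappa> * Rud e a (- s) \<tau> \<rho> \<kappa> \<nu> * matrix_inv e $ \<nu> $ \<beta> * \<sigma> I $ \<tau> $ \<rho>)"

definition X_bar ::
    "complex ^ 2 ^ 2 \<Rightarrow> real \<Rightarrow> (4 \<Rightarrow> complex ^ 2 ^ 2) \<Rightarrow> (4 \<Rightarrow> 'v::complex_vector)
      \<Rightarrow> int \<Rightarrow> 2 \<Rightarrow> 2 \<Rightarrow> 'v"
  where "X_bar e a \<sigma> XI s \<alpha> \<beta> = (\<Sum>I\<in>UNIV. sigma_bar e a \<sigma> s I $ \<alpha> $ \<beta> *\<^sub>C XI I)"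

end

theory Submission
  imports Defs
begin

text \<open>
  Put \<open>q = sqrt a\<close> and \<open>K\<^sub>\<mu>\<^sub>\<kappa> = \<epsilon>\<^sup>\<mu>\<^sup>\<beta> \<epsilon>\<^sub>\<kappa>\<^sub>\<beta>\<close> (\<open>metric_twist\<close>), and let \<open>N\<^sub>s\<close> (\<open>bar_matrix\<close>) be the
  linear map \<open>x \<mapsto> q\<^sup>s x + q\<^sup>-\<^sup>s K(x) 1\<close> on \<open>2\<times>2\<close> matrices, where \<open>K(x)\<close> is the sum of the
  \<open>K\<^sub>\<mu>\<^sub>\<kappa> x\<^sub>\<mu>\<^sub>\<kappa>\<close>. Everything rests on three facts about it.

  (i) \<open>N\<^sub>s\<close> and \<open>N\<^sub>-\<^sub>s\<close> are inverse to each other: they are combinations of the identity and of the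
  rank one map \<open>x \<mapsto> K(x) 1\<close>, and the trace of \<open>K\<close> is \<open>-(a + a\<^sup>-\<^sup>1)\<close> (\<open>bar_matrix_inverse\<close>).

  (ii) Once the metric factors that lower and raise indices have cancelled, the barred matrices are
  \<open>-N\<^sub>s(\<sigma>\<^sup>I)\<close> (\<open>sigma_bar_eq\<close>), so the barred bispinor is \<open>-N\<^sub>s(X)\<close> (\<open>X_bar_eq\<close>).

  (iii) Let \<open>Y\<close> and \<open>W\<close> be the \<open>4\<times>4\<close> matrices over the algebra with entries \<open>M\<^sub>\<alpha>\<^sup>\<mu> M\<^sub>\<sigma>\<^sup>\<kappa>\<close> (second factor
  dotted) and \<open>S\<^sup>-\<^sup>1(M\<^sub>\<mu>\<^sup>\<alpha>) S(M\<^sub>\<kappa>\<^sup>\<sigma>)\<close> (first factor dotted), rows being labelled by \<open>\<alpha>, \<sigma>\<close>. The mixed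
  commutation relation of sign \<open>s\<close>, contracted with the metric in two indices, reads
  \<open>Y N\<^sub>-\<^sub>s = N\<^sub>-\<^sub>s W\<close>. Multiplying by \<open>N\<^sub>s\<close> on both sides turns it, by (i), into \<open>N\<^sub>s Y = W N\<^sub>s\<close>
  (\<open>intertwining\<close>). Since the coaction on \<open>X\<close> is given by \<open>Y\<close>, this is exactly the statement that
  \<open>N\<^sub>s(X)\<close> transforms with \<open>W\<close> (\<open>coaction_X_bar\<close>).

  The reality of the metric makes \<open>K\<close> hermitean, so \<open>N\<^sub>s\<close> commutes with hermitean conjugation; being
  injective by (i), it also reflects hermiticity (\<open>hermitean_sigma_bar_iff\<close>). Finally, if the
  \<open>\<sigma>\<^sup>I\<close> are hermitean, then the \<open>X\<^sub>I\<close> and their conjugates are coefficients of the same expansion in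
  the linearly independent \<open>\<sigma>\<^sup>I\<close>, hence agree (\<open>components_real\<close>).

  Identities in the algebra and in the tensor product are checked by applying all complex linear
  functionals, so that the index computations take place in \<open>\<complex>\<close>.
\<close>

section \<open>Linear functionals and finite sums\<close>

lemma clinear_simps:
  assumes "clinear f"
  shows "f (x + y) = f x + f y" "f (c *\<^sub>C x) = c *\<^sub>C f x" "f (sum g A) = (\<Sum>i\<in>A. f (g i))"
proof -
  interpret Vector_Spaces.linear scaleC scaleC f by (rule assms)
  show "f (x + y) = f x + f y" "f (c *\<^sub>C x) = c *\<^sub>C f x" "f (sum g A) = (\<Sum>i\<in>A. f (g i))"
    by (simp_all add: add scale sum)
qed

lemma clinearI:
  assumes "\<And>x y. f (x + y) = f x + f y" "\<And>c x. f (c *\<^sub>C x) = c *\<^sub>C f x"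
  shows "clinear f"
proof -
  interpret V: vector_space "scaleC :: complex \<Rightarrow> 'a \<Rightarrow> 'a" by (rule vector_space_scaleC)
  interpret W: vector_space "scaleC :: complex \<Rightarrow> 'b \<Rightarrow> 'b" by (rule vector_space_scaleC)
  show ?thesis by unfold_locales (simp_all add: assms)
qed

text \<open>A nonzero vector extends to a basis, so some functional takes the value 1 on it.\<close>

lemma functional_eqI:
  fixes x y :: "'v::complex_vector"
  assumes "\<And>\<phi> :: 'v \<Rightarrow> complex. clinear \<phi> \<Longrightarrow> \<phi> x = \<phi> y"
  shows "x = y"
proof (rule ccontr)
  assume "x \<noteq> y"
  interpret V: vector_space "scaleC :: complex \<Rightarrow> 'v \<Rightarrow> 'v" by (rule vector_space_scaleC)
  interpret VC: vector_space_pair "scaleC :: complex \<Rightarrow> 'v \<Rightarrow> 'v" "scaleC :: complex \<Rightarrow> complex \<Rightarrow> complex"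
    by (intro vector_space_pair.intro vector_space_scaleC)
  have "V.independent {x - y}" using \<open>x \<noteq> y\<close> by simp
  then obtain \<phi> :: "'v \<Rightarrow> complex" where lin: "clinear \<phi>" and one: "\<phi> (x - y) = 1"
    using VC.linear_independent_extend[of "{x - y}" "\<lambda>_. 1"] by auto
  have "\<phi> x = \<phi> (x - y) + \<phi> y" using clinear_simps(1)[OF lin, of "x - y" y] by simp
  then show False using assms[OF lin] one by simp
qed

lemma sum_prod_UNIV:
  "(\<Sum>p\<in>(UNIV :: ('i::finite \<times> 'j::finite) set). g p) = (\<Sum>i\<in>UNIV. \<Sum>j\<in>UNIV. g (i, j))"
  by (simp add: sum.cartesian_product UNIV_Times_UNIV[symmetric] del: UNIV_Times_UNIV)

section \<open>The matrix that bars a bispinor\<close>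

definition half_pow :: "real \<Rightarrow> int \<Rightarrow> complex"
  where "half_pow a s = complex_of_real (sqrt a powi s)"

lemma cnj_half_pow: "cnj (half_pow a s) = half_pow a s"
  unfolding half_pow_def by (rule complex_cnj_complex_of_real)

text \<open>This matrix is the obstruction to the metric being antisymmetric: for antisymmetric \<open>e\<close> it is
  minus the identity.\<close>

definition metric_twist :: "complex ^ 2 ^ 2 \<Rightarrow> 2 \<Rightarrow> 2 \<Rightarrow> complex"
  where "metric_twist e \<mu> \<kappa> = (\<Sum>\<beta>\<in>UNIV. matrix_inv e $ \<mu> $ \<beta> * e $ \<kappa> $ \<beta>)"

text \<open>Index pairs label rows and columns, so that composing maps on \<open>2\<times>2\<close> matrices is a matrix
  product.\<close>

definition bar_matrix :: "complex ^ 2 ^ 2 \<Rightarrow> real \<Rightarrow> int \<Rightarrow> complex ^ (2 \<times> 2) ^ (2 \<times> 2)"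
  where "bar_matrix e a s = (\<chi> p q. half_pow a s * of_bool (p = q)
    + half_pow a (- s) * of_bool (fst p = snd p) * metric_twist e (fst q) (snd q))"

context spinor_metric
begin

lemma metric_inverse: "(\<Sum>\<gamma>\<in>UNIV. e $ \<alpha> $ \<gamma> * matrix_inv e $ \<gamma> $ \<beta>) = of_bool (\<alpha> = \<beta>)"
  "(\<Sum>\<gamma>\<in>UNIV. matrix_inv e $ \<alpha> $ \<gamma> * e $ \<gamma> $ \<beta>) = of_bool (\<alpha> = \<beta>)"
proof -
  have "(e ** matrix_inv e) $ \<alpha> $ \<beta> = mat 1 $ \<alpha> $ \<beta>"
    "(matrix_inv e ** e) $ \<alpha> $ \<beta> = mat 1 $ \<alpha> $ \<beta>"
    using someI_ex[OF invertible_e[unfolded invertible_def]] unfolding matrix_inv_def by simp_all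
  then show "(\<Sum>\<gamma>\<in>UNIV. e $ \<alpha> $ \<gamma> * matrix_inv e $ \<gamma> $ \<beta>) = of_bool (\<alpha> = \<beta>)"
  "(\<Sum>\<gamma>\<in>UNIV. matrix_inv e $ \<alpha> $ \<gamma> * e $ \<gamma> $ \<beta>) = of_bool (\<alpha> = \<beta>)"
    by (simp_all add: matrix_matrix_mult_def mat_def)
qed

lemma cnj_e: "cnj (e $ \<alpha> $ \<beta>) = - (matrix_inv e $ \<alpha> $ \<beta>)"
  "cnj (matrix_inv e $ \<alpha> $ \<beta>) = - (e $ \<alpha> $ \<beta>)"
  using dotted_lower[of \<beta> \<alpha>] dotted_upper[of \<beta> \<alpha>] by (simp_all add: dotted_def)

lemma trace_metric_twist: "(\<Sum>\<alpha>\<in>UNIV. metric_twist e \<alpha> \<alpha>) = - complex_of_real (a + inverse a)"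
  using a_eq by (simp add: metric_twist_def add_eq_0_iff2)

lemma cnj_metric_twist: "cnj (metric_twist e \<alpha> \<beta>) = metric_twist e \<beta> \<alpha>"
  by (simp add: metric_twist_def cnj_e mult.commute)

text \<open>The reality condition turns the contraction of the metric with its inverse into minus the sum of
  the squared moduli of its entries; hence \<open>a + a\<^sup>-\<^sup>1 \<ge> 0\<close>. Positivity is what makes the square of
  \<open>sqrt a\<close> equal to \<open>a\<close>.\<close>

lemma a_pos: "a > 0"
proof -
  have "(\<Sum>\<alpha>\<in>UNIV. \<Sum>\<beta>\<in>UNIV. matrix_inv e $ \<alpha> $ \<beta> * e $ \<alpha> $ \<beta>)
      = - (\<Sum>\<alpha>\<in>UNIV. \<Sum>\<beta>\<in>UNIV. complex_of_real ((cmod (e $ \<alpha> $ \<beta>))\<^sup>2))"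
    unfolding sum_negf[symmetric] using cnj_e(1)
    by (intro sum.cong refl) (metis complex_norm_square minus_mult_right minus_minus mult.commute)
  with a_eq have "complex_of_real (a + inverse a)
      = complex_of_real (\<Sum>\<alpha>\<in>UNIV. \<Sum>\<beta>\<in>UNIV. (cmod (e $ \<alpha> $ \<beta>))\<^sup>2)"
    by simp
  then have "a + inverse a = (\<Sum>\<alpha>\<in>UNIV. \<Sum>\<beta>\<in>UNIV. (cmod (e $ \<alpha> $ \<beta>))\<^sup>2)"
    using of_real_eq_iff by blast
  then have "a + inverse a \<ge> 0" by (simp add: sum_nonneg)
  then show ?thesis
    using a_nonzero by (smt (verit) inverse_negative_iff_negative)
qed

lemma half_pow:
  fixes s :: int
  shows "half_pow a s * half_pow a (- s) = 1"
    "complex_of_real (a powi s) = half_pow a s * half_pow a s"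
proof -
  show "half_pow a s * half_pow a (- s) = 1"
    using a_pos by (simp add: half_pow_def power_int_minus del: of_real_power_int flip: of_real_mult)
  have "a powi s = (sqrt a * sqrt a) powi s" using a_pos by simp
  then show "complex_of_real (a powi s) = half_pow a s * half_pow a s"
    by (simp only: power_int_mult_distrib of_real_mult half_pow_def)
qed

text \<open>With \<open>u = q\<^sup>s\<close>, \<open>v = q\<^sup>-\<^sup>s\<close> and \<open>E\<close> the rank one map, \<open>E\<^sup>2 = tr(K) E = -(u\<^sup>2 + v\<^sup>2) E\<close>, so that
  \<open>(u + v E)(v + u E) = 1 + (u\<^sup>2 + v\<^sup>2) E + E\<^sup>2 = 1\<close>.\<close>

lemma bar_matrix_inverse:
  assumes "s \<in> {1, -1}"
  shows "bar_matrix e a s ** bar_matrix e a (- s) = mat 1"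
proof -
  define u v where "u = half_pow a s" and "v = half_pow a (- s)"
  have uv: "u * v = 1" by (simp add: u_def v_def half_pow)
  have "complex_of_real (a + inverse a) = complex_of_real (a powi s) + complex_of_real (a powi (- s))"
    using assms by (auto simp: power_int_minus)
  then have tr: "metric_twist e 1 1 + metric_twist e 2 2 = - (u * u + v * v)"
    using trace_metric_twist unfolding half_pow(2) u_def v_def by (simp add: UNIV_2)
  have "(bar_matrix e a s ** bar_matrix e a (- s)) $ (\<alpha>, \<sigma>) $ (\<mu>, \<kappa>) = mat 1 $ (\<alpha>, \<sigma>) $ (\<mu>, \<kappa>)" for \<alpha> \<sigma> \<mu> \<kappa>
  proof -
    have "(bar_matrix e a s ** bar_matrix e a (- s)) $ (\<alpha>, \<sigma>) $ (\<mu>, \<kappa>)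
      = u * v * of_bool ((\<alpha>, \<sigma>) = (\<mu>, \<kappa>))
        + of_bool (\<alpha> = \<sigma>) * metric_twist e \<mu> \<kappa> * (u * u + v * v + u * v * (metric_twist e 1 1 + metric_twist e 2 2))"
      using exhaust_2[of \<alpha>] exhaust_2[of \<sigma>] exhaust_2[of \<mu>] exhaust_2[of \<kappa>]
      by (auto simp: matrix_matrix_mult_def bar_matrix_def sum_prod_UNIV UNIV_2 u_def[symmetric]
          v_def[symmetric] algebra_simps)
    also have "\<dots> = mat 1 $ (\<alpha>, \<sigma>) $ (\<mu>, \<kappa>)"
      by (simp add: uv tr mat_def)
    finally show ?thesis .
  qed
  then show ?thesis by (simp add: vec_eq_iff)
qed

lemma Rdu_eq:
  "Rdu e a s \<delta> \<gamma> \<alpha> \<sigma> = half_pow a s * of_bool (\<gamma> = \<delta>) * of_bool (\<sigma> = \<alpha>)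
    + half_pow a (- s) * matrix_inv e $ \<gamma> $ \<sigma> * e $ \<delta> $ \<alpha>"
proof -
  have "half_pow a s * complex_of_real (a powi (- s))
      = half_pow a (- s)"
    unfolding half_pow(2) mult.assoc[symmetric] half_pow(1) by simp
  then show ?thesis
    unfolding Rdu_def Rmat_def half_pow_def[symmetric] distrib_left mult.assoc[symmetric] by simp
qed

text \<open>The next two identities convert the mixed R matrix on either side of the commutation relation
  into the matrix of opposite sign: on the left the metric cancels against the second term of the R
  matrix and produces the identity, while on the right it is the metric factors hidden in the
  antipodes that are absorbed.\<close>

lemma Rdu_contract:
  "(\<Sum>\<rho>\<in>UNIV. \<Sum>\<beta>\<in>UNIV. matrix_inv e $ \<mu> $ \<rho> * e $ \<kappa> $ \<beta> * Rdu e a s \<rho> \<beta> \<gamma> \<delta>)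
    = bar_matrix e a (- s) $ (\<gamma>, \<delta>) $ (\<mu>, \<kappa>)"
proof -
  define u v where "u = half_pow a s" and "v = half_pow a (- s)"
  have "(\<Sum>\<rho>\<in>UNIV. \<Sum>\<beta>\<in>UNIV. matrix_inv e $ \<mu> $ \<rho> * e $ \<kappa> $ \<beta> * Rdu e a s \<rho> \<beta> \<gamma> \<delta>)
     = u * of_bool (\<gamma> = \<delta>) * metric_twist e \<mu> \<kappa>
      + v * ((\<Sum>\<rho>\<in>UNIV. matrix_inv e $ \<mu> $ \<rho> * e $ \<rho> $ \<gamma>)
        * (\<Sum>\<beta>\<in>UNIV. e $ \<kappa> $ \<beta> * matrix_inv e $ \<beta> $ \<delta>))"
    by (simp add: Rdu_eq metric_twist_def u_def[symmetric] v_def[symmetric] UNIV_2 algebra_simps)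
  also have "\<dots> = bar_matrix e a (- s) $ (\<gamma>, \<delta>) $ (\<mu>, \<kappa>)"
    by (auto simp: metric_inverse bar_matrix_def u_def v_def)
  finally show ?thesis .
qed

lemma bar_matrix_contract:
  "(\<Sum>\<tau>\<in>UNIV. \<Sum>\<rho>\<in>UNIV. bar_matrix e a (- s) $ (\<alpha>, \<sigma>) $ (\<tau>, \<rho>) * (e $ \<delta> $ \<tau> * matrix_inv e $ \<gamma> $ \<rho>))
    = Rdu e a s \<delta> \<gamma> \<alpha> \<sigma>"
proof -
  define u v where "u = half_pow a s" and "v = half_pow a (- s)"
  have "(\<Sum>\<tau>\<in>UNIV. \<Sum>\<rho>\<in>UNIV. bar_matrix e a (- s) $ (\<alpha>, \<sigma>) $ (\<tau>, \<rho>) * (e $ \<delta> $ \<tau> * matrix_inv e $ \<gamma> $ \<rho>))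
     = v * (e $ \<delta> $ \<alpha> * matrix_inv e $ \<gamma> $ \<sigma>)
      + u * of_bool (\<alpha> = \<sigma>) * (\<Sum>\<beta>\<in>UNIV. (\<Sum>\<tau>\<in>UNIV. e $ \<delta> $ \<tau> * matrix_inv e $ \<tau> $ \<beta>)
        * (\<Sum>\<rho>\<in>UNIV. matrix_inv e $ \<gamma> $ \<rho> * e $ \<rho> $ \<beta>))"
    using exhaust_2[of \<alpha>] exhaust_2[of \<sigma>]
    by (auto simp add: bar_matrix_def metric_twist_def u_def[symmetric] v_def[symmetric] UNIV_2 algebra_simps)
  also have "\<dots> = Rdu e a s \<delta> \<gamma> \<alpha> \<sigma>"
    unfolding metric_inverse using exhaust_2[of \<gamma>] exhaust_2[of \<delta>]
    by (auto simp: Rdu_eq u_def v_def UNIV_2)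
  finally show ?thesis .
qed

text \<open>By the reality condition the metric raising the dotted index is, up to the sign in front,
  inverse to the upper metric in the definition of \<open>Rud\<close>, so the two cancel. The metric raising the
  undotted index then cancels against a lower metric in each of the two terms of the R matrix.\<close>

lemma sigma_bar_eq:
  "sigma_bar e a \<sigma> s I $ \<alpha> $ \<beta>
    = - (\<Sum>q\<in>UNIV. bar_matrix e a s $ (\<alpha>, \<beta>) $ q * \<sigma> I $ fst q $ snd q)"
proof -
  define u v where "u = half_pow a s" and "v = half_pow a (- s)"
  have lower: "(\<Sum>\<kappa>\<in>UNIV. dotted (matrix_inv e) $ \<alpha> $ \<kappa> * Rud e a (- s) \<tau> \<rho> \<kappa> \<nu>)
      = - (u * (\<Sum>\<mu>\<in>UNIV. e $ \<rho> $ \<mu> * Rmat e a (- s) \<tau> \<mu> \<alpha> \<nu>))" for \<tau> \<rho> \<nu>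
  proof -
    have "(\<Sum>\<kappa>\<in>UNIV. dotted (matrix_inv e) $ \<alpha> $ \<kappa> * Rud e a (- s) \<tau> \<rho> \<kappa> \<nu>)
      = - (u * (\<Sum>\<mu>\<in>UNIV. e $ \<rho> $ \<mu> * (\<Sum>\<omega>\<in>UNIV. Rmat e a (- s) \<tau> \<mu> \<omega> \<nu> *
          (\<Sum>\<kappa>\<in>UNIV. matrix_inv e $ \<omega> $ \<kappa> * e $ \<kappa> $ \<alpha>))))"
      by (simp add: Rud_def half_pow_def[symmetric] dotted_upper UNIV_2 u_def algebra_simps del: of_real_power_int)
    also have "\<dots> = - (u * (\<Sum>\<mu>\<in>UNIV. e $ \<rho> $ \<mu> * Rmat e a (- s) \<tau> \<mu> \<alpha> \<nu>))"
      unfolding metric_inverse by simp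
    finally show ?thesis .
  qed
  have R: "u * Rmat e a (- s) \<tau> \<mu> \<alpha> \<nu>
      = u * of_bool (\<tau> = \<alpha>) * of_bool (\<mu> = \<nu>) + v * matrix_inv e $ \<tau> $ \<mu> * e $ \<alpha> $ \<nu>" for \<tau> \<mu> \<nu>
    using Rdu_eq[of s \<alpha> \<tau> \<nu> \<mu>] by (simp add: Rdu_def half_pow_def[symmetric] u_def v_def mult.assoc del: of_real_power_int)
  have "sigma_bar e a \<sigma> s I $ \<alpha> $ \<beta> = (\<Sum>\<tau>\<in>UNIV. \<Sum>\<rho>\<in>UNIV. \<Sum>\<nu>\<in>UNIV.
      (\<Sum>\<kappa>\<in>UNIV. dotted (matrix_inv e) $ \<alpha> $ \<kappa> * Rud e a (- s) \<tau> \<rho> \<kappa> \<nu>)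
        * matrix_inv e $ \<nu> $ \<beta> * \<sigma> I $ \<tau> $ \<rho>)"
    unfolding sigma_bar_def UNIV_2 by (simp add: algebra_simps)
  also have "\<dots> = - (\<Sum>\<tau>\<in>UNIV. \<Sum>\<rho>\<in>UNIV. (\<Sum>\<mu>\<in>UNIV. e $ \<rho> $ \<mu> *
      (\<Sum>\<nu>\<in>UNIV. (u * Rmat e a (- s) \<tau> \<mu> \<alpha> \<nu>) * matrix_inv e $ \<nu> $ \<beta>)) * \<sigma> I $ \<tau> $ \<rho>)"
    unfolding lower by (simp add: UNIV_2 algebra_simps)
  also have "\<dots> = - (\<Sum>\<tau>\<in>UNIV. \<Sum>\<rho>\<in>UNIV.
      (u * of_bool (\<tau> = \<alpha>) * (\<Sum>\<mu>\<in>UNIV. e $ \<rho> $ \<mu> * matrix_inv e $ \<mu> $ \<beta>)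
      + v * metric_twist e \<tau> \<rho> * (\<Sum>\<nu>\<in>UNIV. e $ \<alpha> $ \<nu> * matrix_inv e $ \<nu> $ \<beta>)) * \<sigma> I $ \<tau> $ \<rho>)"
    unfolding R by (simp add: metric_twist_def UNIV_2 algebra_simps)
  also have "\<dots> = - (\<Sum>\<tau>\<in>UNIV. \<Sum>\<rho>\<in>UNIV. bar_matrix e a s $ (\<alpha>, \<beta>) $ (\<tau>, \<rho>) * \<sigma> I $ \<tau> $ \<rho>)"
    unfolding metric_inverse by (intro arg_cong[where f = uminus] sum.cong refl)
      (auto simp: bar_matrix_def u_def v_def)
  finally show ?thesis by (simp add: sum_prod_UNIV)
qed

end

section \<open>Intertwining and the coaction\<close>

text \<open>The axiom \<open>S \<circ> star \<circ> S \<circ> star = id\<close> makes \<open>S\<close> bijective with inverse \<open>star \<circ> S \<circ> star\<close>.\<close>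

lemma (in star_hopf_algebra) inv_S: "inv S x = star (S (star x))"
proof -
  have "star (S (star (S y))) = y" for y
    by (metis S_star star_star)
  then have "inj S" by (metis injI)
  then show ?thesis using S_star by (metis inv_f_f)
qed


context quantum_SL2C
begin

lemma inv_S_Md:
  "inv S (Md \<tau> \<alpha>) = (\<Sum>\<gamma>\<in>UNIV. \<Sum>\<delta>\<in>UNIV. (e $ \<delta> $ \<alpha> * matrix_inv e $ \<tau> $ \<gamma>) *\<^sub>C Md \<delta> \<gamma>)"
proof -
  have star_add: "star (x + y) = star x + star y" and star_scale: "star (c *\<^sub>C x) = cnj c *\<^sub>C star x"
    for x y c using star_antilinear by (simp_all add: antilinear_def)
  show ?thesis
    by (simp add: inv_S Md_eq star_star S_M UNIV_2 star_add star_scale cnj_e mult.commute)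
qed

text \<open>The contracted relation for sign \<open>s\<close> carries the matrix of sign \<open>-s\<close> on the other side from where
  it is wanted; conjugating with its inverse, the matrix of sign \<open>s\<close>, moves it across. The relation
  is evaluated by an arbitrary functional because the coaction will pair each column of \<open>Y\<close> and \<open>W\<close>
  with a different vector.\<close>

lemma intertwining:
  assumes s: "s \<in> {1, -1}" and \<phi>: "clinear \<phi>"
  defines "Y \<equiv> (\<chi> p q. \<phi> (M (fst p) (fst q) * Md (snd p) (snd q))) :: complex ^ (2 \<times> 2) ^ (2 \<times> 2)"
    and "W \<equiv> (\<chi> p q. \<phi> (inv S (Md (fst q) (fst p)) * S (M (snd q) (snd p)))) :: complex ^ (2 \<times> 2) ^ (2 \<times> 2)"
  shows "bar_matrix e a s ** Y = W ** bar_matrix e a s"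
proof -
  let ?N = "bar_matrix e a"
  define z where "z \<delta> \<rho> \<gamma> \<beta> = \<phi> (Md \<delta> \<rho> * M \<gamma> \<beta>)" for \<delta> \<rho> \<gamma> \<beta>
  note lin = clinear_simps[OF \<phi>]
  have mixed': "(\<Sum>\<gamma>\<in>UNIV. \<Sum>\<delta>\<in>UNIV. Rdu e a s \<rho> \<beta> \<gamma> \<delta> * Y $ (\<alpha>, \<sigma>) $ (\<gamma>, \<delta>))
      = (\<Sum>\<delta>\<in>UNIV. \<Sum>\<gamma>\<in>UNIV. Rdu e a s \<delta> \<gamma> \<alpha> \<sigma> * z \<delta> \<rho> \<gamma> \<beta>)" for \<alpha> \<sigma> \<rho> \<beta>
    using arg_cong[OF mixed[OF s, of \<rho> \<beta> \<alpha> \<sigma>], of \<phi>]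
    by (simp add: lin Y_def z_def scaleC_complex_def)
  \<comment> \<open>All four metric factors of \<open>W\<close> come from the antipodes; the products under \<open>\<phi>\<close> are in the
    order of the right-hand side of the mixed relation.\<close>
  have W: "W $ (\<tau>, \<kappa>') $ (\<mu>, \<kappa>) = (\<Sum>\<rho>\<in>UNIV. \<Sum>\<beta>\<in>UNIV. \<Sum>\<delta>\<in>UNIV. \<Sum>\<gamma>\<in>UNIV.
      matrix_inv e $ \<mu> $ \<rho> * e $ \<kappa> $ \<beta> * (e $ \<delta> $ \<tau> * matrix_inv e $ \<gamma> $ \<kappa>') * z \<delta> \<rho> \<gamma> \<beta>)"
    for \<tau> \<kappa>' \<mu> \<kappa>
    by (simp add: W_def inv_S_Md S_M z_def lin scaleC_complex_def UNIV_2 algebra_simps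
        mult_scaleC_left mult_scaleC_right scaleC_scaleC scaleC_add_right)
  have "(Y ** ?N (- s)) $ (\<alpha>, \<sigma>) $ (\<mu>, \<kappa>) = (?N (- s) ** W) $ (\<alpha>, \<sigma>) $ (\<mu>, \<kappa>)" for \<alpha> \<sigma> \<mu> \<kappa>
  proof -
    have "(Y ** ?N (- s)) $ (\<alpha>, \<sigma>) $ (\<mu>, \<kappa>)
        = (\<Sum>\<gamma>\<in>UNIV. \<Sum>\<delta>\<in>UNIV. Y $ (\<alpha>, \<sigma>) $ (\<gamma>, \<delta>) * ?N (- s) $ (\<gamma>, \<delta>) $ (\<mu>, \<kappa>))"
      by (simp add: matrix_matrix_mult_def sum_prod_UNIV)
    also have "\<dots> = (\<Sum>\<rho>\<in>UNIV. \<Sum>\<beta>\<in>UNIV. matrix_inv e $ \<mu> $ \<rho> * e $ \<kappa> $ \<beta> *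
        (\<Sum>\<gamma>\<in>UNIV. \<Sum>\<delta>\<in>UNIV. Rdu e a s \<rho> \<beta> \<gamma> \<delta> * Y $ (\<alpha>, \<sigma>) $ (\<gamma>, \<delta>)))"
      unfolding Rdu_contract[symmetric] by (simp add: UNIV_2 algebra_simps)
    also have "\<dots> = (\<Sum>\<rho>\<in>UNIV. \<Sum>\<beta>\<in>UNIV. matrix_inv e $ \<mu> $ \<rho> * e $ \<kappa> $ \<beta> *
        (\<Sum>\<delta>\<in>UNIV. \<Sum>\<gamma>\<in>UNIV. (\<Sum>\<tau>\<in>UNIV. \<Sum>\<kappa>'\<in>UNIV. ?N (- s) $ (\<alpha>, \<sigma>) $ (\<tau>, \<kappa>') *
          (e $ \<delta> $ \<tau> * matrix_inv e $ \<gamma> $ \<kappa>')) * z \<delta> \<rho> \<gamma> \<beta>))"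
      unfolding mixed' bar_matrix_contract ..
    also have "\<dots> = (\<Sum>\<tau>\<in>UNIV. \<Sum>\<kappa>'\<in>UNIV. ?N (- s) $ (\<alpha>, \<sigma>) $ (\<tau>, \<kappa>') * W $ (\<tau>, \<kappa>') $ (\<mu>, \<kappa>))"
      unfolding W UNIV_2 by (simp add: algebra_simps)
    also have "\<dots> = (?N (- s) ** W) $ (\<alpha>, \<sigma>) $ (\<mu>, \<kappa>)"
      by (simp add: matrix_matrix_mult_def sum_prod_UNIV)
    finally show ?thesis .
  qed
  then have YN: "Y ** ?N (- s) = ?N (- s) ** W" by (simp add: vec_eq_iff)
  have inv: "?N s ** ?N (- s) = mat 1" "?N (- s) ** ?N s = mat 1"
    using bar_matrix_inverse[of s] bar_matrix_inverse[of "- s"] s by auto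
  have "?N s ** Y = ?N s ** (Y ** ?N (- s)) ** ?N s"
    by (simp add: matrix_mul_assoc[symmetric] inv)
  also have "\<dots> = W ** ?N s"
    by (simp add: YN matrix_mul_assoc inv)
  finally show ?thesis .
qed

end

lemma (in spinor_metric) X_bar_eq:
  fixes XI :: "4 \<Rightarrow> 'v::complex_vector"
  assumes X: "\<And>\<alpha> \<beta>. X \<alpha> \<beta> = (\<Sum>I\<in>UNIV. \<sigma> I $ \<alpha> $ \<beta> *\<^sub>C XI I)"
  shows "X_bar e a \<sigma> XI s \<alpha> \<beta> = - (\<Sum>q\<in>UNIV. bar_matrix e a s $ (\<alpha>, \<beta>) $ q *\<^sub>C X (fst q) (snd q))"
proof -
  interpret V: vector_space "scaleC :: complex \<Rightarrow> 'v \<Rightarrow> 'v" by (rule vector_space_scaleC)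
  have "(\<Sum>q\<in>UNIV. bar_matrix e a s $ (\<alpha>, \<beta>) $ q *\<^sub>C X (fst q) (snd q))
      = (\<Sum>q\<in>UNIV. \<Sum>I\<in>UNIV. (bar_matrix e a s $ (\<alpha>, \<beta>) $ q * \<sigma> I $ fst q $ snd q) *\<^sub>C XI I)"
    by (simp add: X V.scale_sum_right scaleC_scaleC)
  also have "\<dots> = (\<Sum>I\<in>UNIV. (\<Sum>q\<in>UNIV. bar_matrix e a s $ (\<alpha>, \<beta>) $ q * \<sigma> I $ fst q $ snd q) *\<^sub>C XI I)"
    unfolding V.scale_sum_left by (rule sum.swap)
  finally show ?thesis
    by (simp add: X_bar_def sigma_bar_eq V.scale_minus_left sum_negf)
qed

text \<open>For a functional \<open>\<Phi>\<close> on the tensor product and a fixed basis element \<open>X r\<close> in the second factor,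
  \<open>x \<mapsto> \<Phi> (x \<otimes> X r)\<close> is a functional on the algebra; the intertwining relation under it handles the
  \<open>r\<close>-th term of the coaction.\<close>

lemma (in bispinor) coaction_X_bar:
  assumes X: "\<And>\<alpha> \<beta>. X \<alpha> \<beta> = (\<Sum>I\<in>UNIV. \<sigma> I $ \<alpha> $ \<beta> *\<^sub>C XI I)" and s: "s \<in> {1, -1}"
  shows "\<Delta>\<^sub>L (X_bar e a \<sigma> XI s \<alpha> \<beta>)
    = (\<Sum>\<tau>\<in>UNIV. \<Sum>\<rho>\<in>UNIV. (inv S (Md \<tau> \<alpha>) * S (M \<rho> \<beta>)) \<otimes> X_bar e a \<sigma> XI s \<tau> \<rho>)"
proof (rule functional_eqI)
  fix \<Phi> :: "('a, 'v) tensor \<Rightarrow> complex"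
  assume \<Phi>: "clinear \<Phi>"
  let ?N = "bar_matrix e a s" and ?X = "\<lambda>q. X (fst q) (snd q)"
  let ?Y = "\<lambda>p q. M (fst p) (fst q) * Md (snd p) (snd q)"
  let ?W = "\<lambda>p q. inv S (Md (fst q) (fst p)) * S (M (snd q) (snd p))"
  have left: "clinear (\<lambda>x. \<Phi> (x \<otimes> v))" for v
    by (rule clinearI) (simp_all add: tensor_of_add_left tensor_of_scaleC_left clinear_simps[OF \<Phi>])
  have right: "clinear (\<lambda>v. \<Phi> (x \<otimes> v))" for x
    by (rule clinearI) (simp_all add: tensor_of_add_right tensor_of_scaleC_right clinear_simps[OF \<Phi>])
  have coact: "clinear (\<lambda>v. \<Phi> (\<Delta>\<^sub>L v))"
    by (rule clinearI) (simp_all add: clinear_simps[OF \<Phi>] clinear_simps[OF linear_\<Delta>\<^sub>L])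
  have Xbar: "f (X_bar e a \<sigma> XI s \<tau> \<rho>) = - (\<Sum>q\<in>UNIV. ?N $ (\<tau>, \<rho>) $ q * f (?X q))"
    if "clinear f" for f :: "'v \<Rightarrow> complex" and \<tau> \<rho>
  proof -
    interpret Vector_Spaces.linear scaleC scaleC f by (rule that)
    show ?thesis by (simp add: X_bar_eq[of X, OF X] neg sum scale scaleC_complex_def)
  qed
  have commute: "(\<Sum>q\<in>UNIV. ?N $ p $ q * \<Phi> (?Y q r \<otimes> ?X r))
      = (\<Sum>q\<in>UNIV. \<Phi> (?W p q \<otimes> ?X r) * ?N $ q $ r)" for p r
    using arg_cong[OF intertwining[OF s left[of "?X r"]], of "\<lambda>A. A $ p $ r"]
    by (simp add: matrix_matrix_mult_def)
  have "\<Phi> (\<Delta>\<^sub>L (X_bar e a \<sigma> XI s \<alpha> \<beta>))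
      = - (\<Sum>q\<in>UNIV. ?N $ (\<alpha>, \<beta>) $ q * (\<Sum>r\<in>UNIV. \<Phi> (?Y q r \<otimes> ?X r)))"
    by (simp add: Xbar[OF coact] \<Delta>\<^sub>L_X clinear_simps[OF \<Phi>] sum_prod_UNIV)
  also have "\<dots> = - (\<Sum>r\<in>UNIV. \<Sum>q\<in>UNIV. ?N $ (\<alpha>, \<beta>) $ q * \<Phi> (?Y q r \<otimes> ?X r))"
    unfolding sum_distrib_left by (subst sum.swap) (rule refl)
  also have "\<dots> = - (\<Sum>q\<in>UNIV. \<Sum>r\<in>UNIV. ?N $ q $ r * \<Phi> (?W (\<alpha>, \<beta>) q \<otimes> ?X r))"
    unfolding commute by (subst sum.swap) (simp add: mult.commute)
  also have "\<dots> = (\<Sum>q\<in>UNIV. \<Phi> (?W (\<alpha>, \<beta>) q \<otimes> X_bar e a \<sigma> XI s (fst q) (snd q)))"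
    by (simp add: Xbar[OF right] sum_negf)
  finally show "\<Phi> (\<Delta>\<^sub>L (X_bar e a \<sigma> XI s \<alpha> \<beta>))
    = \<Phi> (\<Sum>\<tau>\<in>UNIV. \<Sum>\<rho>\<in>UNIV. (inv S (Md \<tau> \<alpha>) * S (M \<rho> \<beta>)) \<otimes> X_bar e a \<sigma> XI s \<tau> \<rho>)"
    by (simp add: clinear_simps[OF \<Phi>] sum_prod_UNIV)
qed

section \<open>Hermiticity and reality\<close>

text \<open>As \<open>K\<close> is hermitean and the powers of \<open>sqrt a\<close> are real, conjugating the barred matrix amounts to
  barring the conjugate matrix; then injectivity gives the equivalence for each \<open>I\<close> separately.\<close>

lemma (in spinor_metric) hermitean_sigma_bar_iff:
  assumes s: "s \<in> {1, -1}"
  shows "hermitean (sigma_bar e a \<sigma> s I) \<longleftrightarrow> hermitean (\<sigma> I)"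
proof -
  define x :: "complex ^ (2 \<times> 2)" where "x = (\<chi> q. \<sigma> I $ fst q $ snd q)"
  define xh :: "complex ^ (2 \<times> 2)" where "xh = (\<chi> q. cnj (\<sigma> I $ snd q $ fst q))"
  have bar: "sigma_bar e a \<sigma> s I $ \<alpha> $ \<beta> = - ((bar_matrix e a s *v x) $ (\<alpha>, \<beta>))" for \<alpha> \<beta>
    by (simp add: sigma_bar_eq matrix_vector_mult_def x_def)
  have bar_h: "cnj ((bar_matrix e a s *v x) $ (\<beta>, \<alpha>)) = (bar_matrix e a s *v xh) $ (\<alpha>, \<beta>)" for \<alpha> \<beta>
    using exhaust_2[of \<alpha>] exhaust_2[of \<beta>]
    by (auto simp: matrix_vector_mult_def x_def xh_def sum_prod_UNIV UNIV_2 bar_matrix_def cnj_half_pow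
        cnj_metric_twist)
  have "hermitean (sigma_bar e a \<sigma> s I) \<longleftrightarrow> bar_matrix e a s *v xh = bar_matrix e a s *v x"
    unfolding hermitean_def by (auto simp: vec_eq_iff bar_h bar)
  also have "\<dots> \<longleftrightarrow> xh = x"
  proof
    assume eq: "bar_matrix e a s *v xh = bar_matrix e a s *v x"
    have "bar_matrix e a (- s) ** bar_matrix e a s = mat 1"
      using bar_matrix_inverse[of "- s"] s by auto
    with arg_cong[OF eq, of "\<lambda>y. bar_matrix e a (- s) *v y"] show "xh = x"
      by (simp add: matrix_vector_mul_assoc)
  qed simp
  also have "\<dots> \<longleftrightarrow> hermitean (\<sigma> I)"
    unfolding hermitean_def x_def xh_def by (auto simp: vec_eq_iff)
  finally show ?thesis .
qed

text \<open>Independence says that the matrix with the \<open>\<sigma> I\<close> as columns has trivial kernel; the rows of a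
  left inverse form a family of functionals dual to \<open>\<sigma>\<close>.\<close>

lemma lin_indep_left_inverse:
  fixes \<sigma> :: "'i::finite \<Rightarrow> complex ^ 'm ^ 'n"
  assumes "lin_indep \<sigma>"
  shows "\<exists>B. \<forall>I J. (\<Sum>\<alpha>\<in>UNIV. \<Sum>\<beta>\<in>UNIV. B J \<alpha> \<beta> * \<sigma> I $ \<alpha> $ \<beta>) = of_bool (J = I)"
proof -
  define A :: "complex ^ 'i ^ ('n \<times> 'm)" where "A = (\<chi> p I. \<sigma> I $ fst p $ snd p)"
  have "c = 0" if "A *v c = 0" for c
  proof -
    have "(\<Sum>I\<in>UNIV. c $ I *\<^sub>C \<sigma> I) = 0"
      using that by (simp add: vec_eq_iff A_def matrix_vector_mult_def scaleC_vec_def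
          scaleC_complex_def mult.commute)
    then show ?thesis using assms by (simp add: lin_indep_def vec_eq_iff)
  qed
  then obtain B where "B ** A = mat 1"
    using matrix_left_invertible_ker[of A] by blast
  then have "(B ** A) $ J $ I = of_bool (J = I)" for I J
    by (simp add: mat_def)
  then have "(\<Sum>\<alpha>\<in>UNIV. \<Sum>\<beta>\<in>UNIV. B $ J $ (\<alpha>, \<beta>) * \<sigma> I $ \<alpha> $ \<beta>) = of_bool (J = I)" for I J
    by (simp add: matrix_matrix_mult_def A_def sum_prod_UNIV)
  then show ?thesis by (intro exI[of _ "\<lambda>J \<alpha> \<beta>. B $ J $ (\<alpha>, \<beta>)"]) simp
qed

text \<open>Conjugating the expansion of \<open>X\<close> and using that both \<open>X\<close> and the \<open>\<sigma>\<^sup>I\<close> are hermitean expands \<open>X\<close>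
  with the conjugated coefficients; the dual family reads off the coefficients.\<close>

lemma (in bispinor) components_real:
  fixes \<sigma> :: "'i::finite \<Rightarrow> complex ^ 2 ^ 2"
  assumes ind: "lin_indep \<sigma>" and X: "\<And>\<alpha> \<beta>. X \<alpha> \<beta> = (\<Sum>I\<in>UNIV. \<sigma> I $ \<alpha> $ \<beta> *\<^sub>C XI I)"
    and herm: "\<And>I. hermitean (\<sigma> I)"
  shows "starV (XI J) = XI J"
proof -
  interpret V: vector_space "scaleC :: complex \<Rightarrow> 'v \<Rightarrow> 'v" by (rule vector_space_scaleC)
  obtain B where B: "\<And>I J. (\<Sum>\<alpha>\<in>UNIV. \<Sum>\<beta>\<in>UNIV. B J \<alpha> \<beta> * \<sigma> I $ \<alpha> $ \<beta>) = of_bool (J = I)"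
    using lin_indep_left_inverse[OF ind] by blast
  have recover: "(\<Sum>\<alpha>\<in>UNIV. \<Sum>\<beta>\<in>UNIV. B J \<alpha> \<beta> *\<^sub>C (\<Sum>I\<in>UNIV. \<sigma> I $ \<alpha> $ \<beta> *\<^sub>C Z I)) = Z J"
    for Z :: "_ \<Rightarrow> 'v"
  proof -
    have "(\<Sum>\<alpha>\<in>UNIV. \<Sum>\<beta>\<in>UNIV. B J \<alpha> \<beta> *\<^sub>C (\<Sum>I\<in>UNIV. \<sigma> I $ \<alpha> $ \<beta> *\<^sub>C Z I))
      = (\<Sum>I\<in>UNIV. (\<Sum>\<alpha>\<in>UNIV. \<Sum>\<beta>\<in>UNIV. B J \<alpha> \<beta> * \<sigma> I $ \<alpha> $ \<beta>) *\<^sub>C Z I)"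
      by (simp add: UNIV_2 V.scale_sum_right scaleC_scaleC scaleC_add_left sum.distrib)
    also have "\<dots> = (\<Sum>I\<in>UNIV. if J = I then Z I else 0)"
      unfolding B by (intro sum.cong) (auto simp: scaleC_one)
    finally show ?thesis by simp
  qed
  have starV: "starV (x + y) = starV x + starV y" "starV (c *\<^sub>C x) = cnj c *\<^sub>C starV x" for x y c
    using starV_antilinear by (simp_all add: antilinear_def)
  have starV_0: "starV 0 = 0" using starV(1)[of 0 0] by simp
  have starV_sum: "starV (sum g A) = (\<Sum>i\<in>A. starV (g i))" for g and A :: "'i set"
    using starV(1) starV_0 by (induction A rule: infinite_finite_induct) auto
  have "(\<Sum>I\<in>UNIV. \<sigma> I $ \<beta> $ \<alpha> *\<^sub>C starV (XI I)) = (\<Sum>I\<in>UNIV. \<sigma> I $ \<beta> $ \<alpha> *\<^sub>C XI I)" for \<alpha> \<beta>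
  proof -
    have "(\<Sum>I\<in>UNIV. \<sigma> I $ \<beta> $ \<alpha> *\<^sub>C starV (XI I)) = starV (X \<alpha> \<beta>)"
      using herm by (simp add: X starV_sum starV hermitean_def)
    also have "\<dots> = X \<beta> \<alpha>" by (rule starV_X)
    finally show ?thesis by (simp add: X)
  qed
  with recover[of "\<lambda>I. starV (XI I)"] recover[of XI] show ?thesis by simp
qed

theorem mainTheorem1:
  fixes e :: "complex ^ 2 ^ 2" and a :: real
    and star :: "'a::complex_algebra_1 \<Rightarrow> 'a"
    and \<Delta> :: "'a \<Rightarrow> ('a, 'a) tensor" and counit :: "'a \<Rightarrow> complex" and S :: "'a \<Rightarrow> 'a"
    and M Md :: "2 \<Rightarrow> 2 \<Rightarrow> 'a"
    and \<Delta>\<^sub>L :: "'v::complex_vector \<Rightarrow> ('a, 'v) tensor" and starV :: "'v \<Rightarrow> 'v"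
    and X :: "2 \<Rightarrow> 2 \<Rightarrow> 'v"
    and \<sigma> :: "4 \<Rightarrow> complex ^ 2 ^ 2" and XI :: "4 \<Rightarrow> 'v" and s :: int
  assumes "bispinor e a star \<Delta> counit S M Md \<Delta>\<^sub>L starV X"
    and "lin_indep \<sigma>"
    and "\<And>\<alpha> \<beta>. X \<alpha> \<beta> = (\<Sum>I\<in>UNIV. \<sigma> I $ \<alpha> $ \<beta> *\<^sub>C XI I)"
    and "s \<in> {1, -1}"
  shows "(\<forall>\<alpha> \<beta>. \<Delta>\<^sub>L (X_bar e a \<sigma> XI s \<alpha> \<beta>)
        = (\<Sum>\<tau>\<in>UNIV. \<Sum>\<rho>\<in>UNIV. (inv S (Md \<tau> \<alpha>) * S (M \<rho> \<beta>)) \<otimes> X_bar e a \<sigma> XI s \<tau> \<rho>))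
    \<and> ((\<forall>I. hermitean (sigma_bar e a \<sigma> s I)) \<longleftrightarrow> (\<forall>I. hermitean (\<sigma> I)))
    \<and> ((\<forall>I. hermitean (\<sigma> I)) \<longrightarrow> (\<forall>I. starV (XI I) = XI I))"
proof -
  interpret bispinor e a star \<Delta> counit S M Md \<Delta>\<^sub>L starV X by (rule assms(1))
  show ?thesis
    using coaction_X_bar[OF assms(3,4)] hermitean_sigma_bar_iff[OF assms(4)]
      components_real[OF assms(2,3)] by simp
qed

end
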